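(* Consider the game ${\rm SCN}(8,6)$. Its P-positions (among all configurations that can arise, i.e. circular arrangements of at most $8$ piles with positive pile sizes) are exactly the following: (1) the terminal configuration $()$; (2) the seven-pile configurations $(a,a,a,a,a,a,a)$ with $a\ge 1$; (3) the eight-pile configurations $(1,M,a,M-a+1,\alpha,M-b+1,b,M)$ where $M,a,b$ are positive integers with $a\le M$, $b\le M$ and $\alpha=\min\{M,a+b-1\}$, except that the configurations $(1,2p-1,p,p,2p-1,p,p,2p-1)$ with an integer $p\ge 1$ are not P-positions.
   Context: Shrinking Circular Nim ${\rm SCN}(n,k)$, for positive integers $k\le n$: initially $n$ piles of stones are arranged on a circle. Two players alternate turns. On a turn, a player selects $k$ consecutive (cyclically adjacent) piles among the currently remaining piles and removes any number of stones from each of them, removing at least one stone in total (some of the selected piles may be left untouched). Whenever a pile becomes empty it vanishes and the circle closes up: the remaining piles keep their cyclic order and the neighbours of the vanished pile become adjacent. If at most $k$ piles remain, a move may remove stones from any of the remaining piles (all of them may be selected). The player who removes the last stone wins (a player with no move loses). A configuration is written as the tuple $(x_1,\dots,x_r)$ of the positive pile sizes in cyclic order; tuples that agree up to rotation or reflection denote the same configuration, and $()$ denotes the empty (terminal) configuration. A P-position is a configuration from which the player to move loses under optimal play by the opponent. *)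

theory Defs
  imports Main
begin

text \<open>
  Shrinking Circular Nim.  A configuration is represented by the list of its positive pile
  sizes in cyclic order; \<open>scn_same\<close> relates the lists that denote the same configuration.
\<close>

definition scn_config :: "nat \<Rightarrow> nat list \<Rightarrow> bool" where
  "scn_config n xs \<longleftrightarrow> length xs \<le> n \<and> (\<forall>x\<in>set xs. 0 < x)"

definition scn_same :: "nat list \<Rightarrow> nat list \<Rightarrow> bool" where
  "scn_same xs ys \<longleftrightarrow> (\<exists>m. xs = rotate m ys \<or> xs = rotate m (rev ys))"

text \<open>
  The sets of positions a player may select when \<open>r\<close> piles remain: \<open>k\<close> cyclically consecutive
  ones.  If \<open>r \<le> k\<close>, the window wraps around and consists of all \<open>r\<close> positions.
\<close>

definition scn_windows :: "nat \<Rightarrow> nat \<Rightarrow> nat set set" where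
  "scn_windows k r = {(\<lambda>j. (i + j) mod r) ` {..<k} | i. i < r}"

text \<open>
  In a move from \<open>xs\<close>, the list \<open>ys\<close> holds the pile sizes before emptied piles vanish.
\<close>

definition scn_move :: "nat \<Rightarrow> nat list \<Rightarrow> nat list \<Rightarrow> bool" where
  "scn_move k xs zs \<longleftrightarrow>
     (\<exists>W\<in>scn_windows k (length xs). \<exists>ys.
        length ys = length xs \<and>
        (\<forall>i<length xs. ys ! i \<le> xs ! i) \<and>
        (\<forall>i<length xs. i \<notin> W \<longrightarrow> ys ! i = xs ! i) \<and>
        ys \<noteq> xs \<and>
        zs = filter (\<lambda>y. 0 < y) ys)"

text \<open>
  The player to move loses if every move leads to a position that is won for the opponent, in
  particular if there is no move, and wins if some move leads to a position lost for the
  opponent.  Every play is finite, so exactly one of the two holds.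
\<close>

inductive scn_loses :: "nat \<Rightarrow> nat list \<Rightarrow> bool"
  and scn_wins :: "nat \<Rightarrow> nat list \<Rightarrow> bool"
  for k :: nat
where
  "(\<And>ys. scn_move k xs ys \<Longrightarrow> scn_wins k ys) \<Longrightarrow> scn_loses k xs"
| "scn_move k xs ys \<Longrightarrow> scn_loses k ys \<Longrightarrow> scn_wins k xs"

definition scn_P_positions :: "nat \<Rightarrow> nat \<Rightarrow> nat list set" where
  "scn_P_positions n k = {xs. scn_config n xs \<and> scn_loses k xs}"

end

theory Submission
  imports Defs
begin

text \<open>
  Every nonempty configuration with at most six piles is won at once, and with seven piles one pile
  stays untouched, so exactly the constant configurations are lost.  With eight piles two adjacent
  piles stay untouched.  A move between two configurations of type (3) is impossible: a pile of size
  \<open>1\<close> stays \<open>1\<close>, and every such pile can serve as the first one of the pattern, after which two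
  untouched neighbours determine \<open>M\<close>, \<open>a\<close>, \<open>b\<close>.

  For the converse, fix a base pile \<open>x0\<close> and take the largest \<open>M \<le> min x1 x7\<close> for which a pattern
  with first pile \<open>x0\<close> fits below the configuration.  If \<open>M < min x1 x7\<close>, the obstruction to \<open>M + 1\<close>
  provides two adjacent piles that need not be touched.  If \<open>M = min x1 x7\<close>, this can fail only for
  two patterns of inequalities between the piles, and these cannot hold for all base piles and
  both orientations simultaneously, as one sees next to a smallest pile.
\<close>

section \<open>Patterns below a linear arrangement of seven piles\<close>

text \<open>\<open>frame M a c e d b\<close> lists the piles of a non-exceptional P-position \<open>[1, M, a, c, e, d, b, M]\<close>.
  The predicate \<open>framed\<close> says that \<open>[x0, \<dots>, x7]\<close> reaches such a position, or a position of seven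
  equal piles, while two adjacent piles other than \<open>x0\<close> are kept and \<open>x0\<close> is cut to \<open>1\<close> or \<open>0\<close>.\<close>

definition frame :: "nat \<Rightarrow> nat \<Rightarrow> nat \<Rightarrow> nat \<Rightarrow> nat \<Rightarrow> nat \<Rightarrow> bool" where
  "frame M a c e d b \<longleftrightarrow> 0 < a \<and> 0 < b \<and> 0 < c \<and> 0 < d \<and> a + c = M + 1 \<and> b + d = M + 1 \<and>
     (e = M \<and> M < a + b \<or> e < M \<and> e + 1 = a + b) \<and> \<not> (a = b \<and> a = c)"

inductive framed :: "nat \<Rightarrow> nat \<Rightarrow> nat \<Rightarrow> nat \<Rightarrow> nat \<Rightarrow> nat \<Rightarrow> nat \<Rightarrow> bool" where
  framedI: "frame M a c e d b \<Longrightarrow>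
    M \<le> x1 \<Longrightarrow> a \<le> x2 \<Longrightarrow> c \<le> x3 \<Longrightarrow> e \<le> x4 \<Longrightarrow> d \<le> x5 \<Longrightarrow> b \<le> x6 \<Longrightarrow> M \<le> x7 \<Longrightarrow>
    M = x1 \<and> a = x2 \<or> a = x2 \<and> c = x3 \<or> c = x3 \<and> e = x4 \<or> e = x4 \<and> d = x5 \<or>
      d = x5 \<and> b = x6 \<or> b = x6 \<and> M = x7 \<Longrightarrow>
    framed x1 x2 x3 x4 x5 x6 x7"
| framed_flatI: "0 < c \<Longrightarrow>
    c \<le> x1 \<Longrightarrow> c \<le> x2 \<Longrightarrow> c \<le> x3 \<Longrightarrow> c \<le> x4 \<Longrightarrow> c \<le> x5 \<Longrightarrow> c \<le> x6 \<Longrightarrow> c \<le> x7 \<Longrightarrow>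
    x1 = c \<and> x2 = c \<or> x2 = c \<and> x3 = c \<or> x3 = c \<and> x4 = c \<or> x4 = c \<and> x5 = c \<or>
      x5 = c \<and> x6 = c \<or> x6 = c \<and> x7 = c \<Longrightarrow>
    framed x1 x2 x3 x4 x5 x6 x7"

lemma framed_sym:
  assumes "framed x7 x6 x5 x4 x3 x2 x1"
  shows "framed x1 x2 x3 x4 x5 x6 x7"
  using assms
proof cases
  case (framedI M a c e d b)
  have "frame M b d e c a" using framedI(1) unfolding frame_def by auto
  moreover have "M = x1 \<and> b = x2 \<or> b = x2 \<and> d = x3 \<or> d = x3 \<and> e = x4 \<or> e = x4 \<and> c = x5 \<or>
       c = x5 \<and> a = x6 \<or> a = x6 \<and> M = x7"
    using framedI(9) by (elim disjE) simp_all
  ultimately show ?thesis using framedI(2-8) by (intro framed.framedI[of M b d e c a]) assumption+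
next
  case (framed_flatI c)
  moreover have "x1 = c \<and> x2 = c \<or> x2 = c \<and> x3 = c \<or> x3 = c \<and> x4 = c \<or> x4 = c \<and> x5 = c \<or>
       x5 = c \<and> x6 = c \<or> x6 = c \<and> x7 = c"
    using framed_flatI(9) by (elim disjE) simp_all
  ultimately show ?thesis by (intro framed.framed_flatI[of c]) assumption+
qed

text \<open>The smallest possible \<open>a\<close> and \<open>b\<close> are \<open>M + 1 - min M x3\<close> and \<open>M + 1 - min M x5\<close>; so \<open>fits\<close> says
  that for this \<open>M\<close> some choice of \<open>a\<close>, \<open>b\<close> lies below \<open>x2, \<dots>, x6\<close>.\<close>

definition fits :: "nat \<Rightarrow> nat \<Rightarrow> nat \<Rightarrow> nat \<Rightarrow> nat \<Rightarrow> nat \<Rightarrow> bool" where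
  "fits M x2 x3 x4 x5 x6 \<longleftrightarrow> M < x2 + x3 \<and> M < x5 + x6 \<and>
     (M \<le> x4 \<or> 2 * M + 1 \<le> x4 + min M x3 + min M x5)"

text \<open>As \<open>x2 + x3 = M + 1\<close>, these two piles can be kept as \<open>a\<close> and
  \<open>c\<close>. On the other side \<open>b\<close> is taken as small as possible, so that
  \<open>e\<close> fits below \<open>x4\<close>. In the exceptional case \<open>x2 = x3 = b\<close>
  none of the seven piles is smaller than \<open>x2\<close>, and seven piles of that size are
  reached instead.\<close>

lemma framed_pair_exact:
  assumes "0 < x2" "0 < x3" "0 < x4" "0 < x5" "0 < x6"
  and "M \<le> x1" "M \<le> x7" and f: "fits M x2 x3 x4 x5 x6" and "x2 + x3 = M + 1"
  shows "framed x1 x2 x3 x4 x5 x6 x7"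
proof -
  define d where "d = min M x5"
  define b where "b = M + 1 - d"
  define e where "e = min M (x2 + b - 1)"
  have d: "d \<le> M" "d \<le> x5" "d = M \<or> d = x5" "0 < d" "b + d = M + 1" "0 < b" "b \<le> x6"
    using assms unfolding d_def b_def fits_def by linarith+
  have m: "min M x3 = x3" "min M x5 = d" using assms d_def by auto
  have e: "e \<le> x4" "e = M \<and> M < x2 + b \<or> e < M \<and> e + 1 = x2 + b"
    using f d \<open>x2 + x3 = M + 1\<close> \<open>0 < x2\<close> unfolding e_def fits_def m by linarith+
  show ?thesis
  proof (cases "x2 = b \<and> x2 = x3")
    case False
    then show ?thesis using assms d e by (intro framedI[of M x2 x3 e d b]) (auto simp: frame_def)
  next
    case True
    then show ?thesis using assms d e by (intro framed_flatI[of x2]) auto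
  qed
qed

text \<open>\<open>M + 1\<close> fails for one of two reasons: a pair sum equals
  \<open>M + 1\<close>, and this pair is kept; or \<open>x4\<close> is too small, and
  \<open>x4\<close> is kept together with \<open>x3\<close> or \<open>x5\<close>.\<close>

lemma framed_below:
  assumes pos: "0 < x2" "0 < x3" "0 < x4" "0 < x5" "0 < x6"
  and M: "0 < M" "M \<le> x1" "M \<le> x7" and f: "fits M x2 x3 x4 x5 x6" and nf: "\<not> fits (Suc M) x2 x3 x4 x5 x6"
  shows "framed x1 x2 x3 x4 x5 x6 x7"
proof -
  consider "x2 + x3 = M + 1" | "x5 + x6 = M + 1" 
    | "M + 2 \<le> x2 + x3" "M + 2 \<le> x5 + x6" using f unfolding fits_def by linarith
  then show ?thesis
  proof cases
    case 1 then show ?thesis by (rule framed_pair_exact[OF pos M(2,3) f])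
  next
    case 2
    have "fits M x6 x5 x4 x3 x2" using f unfolding fits_def by (simp add: ac_simps)
    then have "framed x7 x6 x5 x4 x3 x2 x1"
      using 2 by (intro framed_pair_exact[OF pos(5,4,3,2,1) M(3,2)]) simp_all
    then show ?thesis by (rule framed_sym)
  next
    case 3
    have x4: "x4 \<le> M" "x4 + min (Suc M) x3 + min (Suc M) x5 < 2 * M + 3"
      using nf 3 unfolding fits_def by auto
    show ?thesis
    proof (cases "x4 = M")
      case True
      have s: "min (Suc M) x3 + min (Suc M) x5 \<le> M + 2" using x4 True by linarith
      consider "M < x3" | "M < x5" | "x3 \<le> M" "x5 \<le> M" "x3 + x5 \<le> M + 2"
        using s by linarith
      then show ?thesis
      proof cases
        case 1
        then have "x5 = 1" using s pos M by linarith
        show ?thesis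
        proof (cases "M = 1")
          case True then show ?thesis using \<open>x4 = M\<close> \<open>x5 = 1\<close> assms
            by (intro framed_flatI[of 1]) auto
        next
          case False then show ?thesis using \<open>x4 = M\<close> \<open>x5 = 1\<close> 1 3 assms
            by (intro framedI[of M 1 M M 1 M]) (auto simp: frame_def)
        qed
      next
        case 2
        then have "x3 = 1" using s pos M by linarith
        show ?thesis
        proof (cases "M = 1")
          case True then show ?thesis using \<open>x4 = M\<close> \<open>x3 = 1\<close> assms
            by (intro framed_flatI[of 1]) auto
        next
          case False then show ?thesis using \<open>x4 = M\<close> \<open>x3 = 1\<close> 2 3 assms
            by (intro framedI[of M M 1 M M 1]) (auto simp: frame_def)
        qed
      next
        case c: 3
        \<comment> \<open>Keep \<open>x3\<close> and \<open>x4\<close>: \<open>c = x3\<close> fixes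
          \<open>a\<close>, and the largest possible \<open>b\<close> gives \<open>M < a + b\<close>
          because \<open>x3 \<le> x6\<close>. The second assumption excludes the exceptional
          pattern.\<close>
        have L: ?thesis if "x3 \<le> x6" "\<not> (x6 = x3 \<and> M = 2 * x3 - 1)"
        proof -
          obtain b where b: "b = min M x6" by blast
          obtain a where a: "a = M + 1 - x3" by blast
          obtain d where d: "d = M + 1 - b" by blast
          show ?thesis 
          proof (cases "M = 1")
            case True then show ?thesis using c \<open>x4 = M\<close> assms
              by (intro framed_flatI[of 1]) auto
          next
            case False
            have b': "x3 \<le> b" "b \<le> M" "b \<le> x6" "b = M \<or> b = x6" using b that c by simp_all linarith?
            have "frame M a x3 M d b"
              using that a d b' c pos False unfolding frame_def
              by (intro conjI disjI1) linarith+
            moreover have "a \<le> x2" "d \<le> x5" using a d b' c 3 pos by linarith+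
            ultimately show ?thesis using \<open>x4 = M\<close> M b' by (intro framedI[of M a x3 M d b]) simp_all
          qed
        qed
        have R: ?thesis if "x5 \<le> x2" "\<not> (x2 = x5 \<and> M = 2 * x5 - 1)"
        proof -
          obtain a where a: "a = min M x2" by blast
          obtain b where b: "b = M + 1 - x5" by blast
          obtain cc where d: "cc = M + 1 - a" by blast
          show ?thesis 
          proof (cases "M = 1")
            case True then show ?thesis using c \<open>x4 = M\<close> assms
              by (intro framed_flatI[of 1]) auto
          next
            case False
            have a': "x5 \<le> a" "a \<le> M" "a \<le> x2" "a = M \<or> a = x2" using a that c by simp_all linarith?
            have "frame M a cc M x5 b"
              using that b d a' c pos False unfolding frame_def
              by (intro conjI disjI1) linarith+
            moreover have "b \<le> x6" "cc \<le> x3" using b d a' c 3 pos by linarith+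
            ultimately show ?thesis using \<open>x4 = M\<close> M a' by (intro framedI[of M a cc M x5 b]) simp_all
          qed
        qed
        \<comment> \<open>The bounds give \<open>x3 + x5 \<le> x2 + x6\<close>, so
          \<open>x3 \<le> x6\<close> or \<open>x5 \<le> x2\<close>; if one side is exceptional, the
          other one applies.\<close>
        show ?thesis using L R c 3 by linarith
      qed
    next
      case False
      then have "x4 < M" using x4 by simp
      then have g: "2 * M + 1 \<le> x4 + min M x3 + min M x5" using f unfolding fits_def by auto
      \<comment> \<open>The largest \<open>c\<close>, \<open>d\<close> give the smallest
        \<open>a\<close>, \<open>b\<close>, hence the smallest sum to be compared with
        \<open>x4 + 1\<close>.\<close>
      define c where "c = min M x3"
      define d where "d = min M x5"
      define a where "a = M + 1 - c"
      define b where "b = M + 1 - d"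
      have cd: "0 < c" "0 < d" "a + c = M + 1" "b + d = M + 1" "0 < a" "0 < b" "c \<le> x3" "d \<le> x5"
        "a \<le> x2" "b \<le> x6"
        using assms 3 unfolding c_def d_def a_def b_def by auto
      have "a + b \<le> x4 + 1" using g cd unfolding c_def[symmetric] d_def[symmetric] by linarith
      then consider "x4 + 1 = a + b" | "x4 + 1 > a + b" by linarith
      then show ?thesis
      proof cases
        case 1
        \<comment> \<open>If both exceeded \<open>M\<close>, then \<open>M + 1\<close> would fit
          with the same \<open>a\<close> and \<open>b\<close>.\<close>
        then have "x3 \<le> M \<or> x5 \<le> M"
          using nf 3 g cd unfolding fits_def c_def d_def by auto
        then have "c = x3 \<or> d = x5" unfolding c_def d_def by auto
        then show ?thesis using 1 cd \<open>x4 < M\<close> assms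
          by (intro framedI[of M a c x4 d b]) (auto simp: frame_def)
      next
        case 2
        \<comment> \<open>Failure of \<open>M + 1\<close> limits the excess of \<open>x4 + 1\<close>
          over \<open>a + b\<close> to one unit, which is used up by raising \<open>a\<close> or
          \<open>b\<close> at the cost of \<open>c\<close> or \<open>d\<close>.\<close>
        have e: "x3 \<le> M" "x5 \<le> M" "x4 = a + b" using 2 x4 cd g unfolding c_def d_def by linarith+
        then have cd': "c = x3" "d = x5" unfolding c_def d_def by auto
        show ?thesis
        proof (cases "1 < c")
          case True
          then show ?thesis using e cd' cd 3 \<open>x4 < M\<close> assms
          by (intro framedI[of M "a+1" "c-1" x4 d b]) (auto simp: frame_def)
        next
          case False
          then show ?thesis using e cd' cd 3 \<open>x4 < M\<close> assms
          by (intro framedI[of M a c x4 "d-1" "b+1"]) (auto simp: frame_def)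
        qed
      qed
    qed
  qed
qed

text \<open>The pattern in which, after orienting the circle so that \<open>x1 \<le> x7\<close>, a base at pile \<open>0\<close> may fail.\<close>

definition blocked :: "nat \<Rightarrow> nat \<Rightarrow> nat \<Rightarrow> nat \<Rightarrow> bool" where
  "blocked x1 x2 x4 x5 \<longleftrightarrow> x1 < x2 \<and> (x1 < x4 \<or> x1 < x5) \<or> x4 < x2 \<and> x2 \<le> x1 \<and> x1 < x5"

text \<open>For \<open>M = x1\<close> there are two plans: keep \<open>x1\<close>, \<open>x2\<close>
  with \<open>a = x2\<close>, or keep \<open>x4\<close>, \<open>x5\<close> with \<open>a\<close>
  chosen so that \<open>e = x4\<close>. Up to the exceptional pattern, both fail only under the
  inequalities of \<open>blocked\<close>.\<close>

lemma framed_top: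
  assumes pos: "0 < x1" "0 < x2" "0 < x3" "0 < x4" "0 < x5" "0 < x6"
  and le: "x1 \<le> x7" and f: "fits x1 x2 x3 x4 x5 x6"
  and r: "\<not> blocked x1 x2 x4 x5"
  shows "framed x1 x2 x3 x4 x5 x6 x7"
proof -
  define c where "c = min x1 x3"
  define d where "d = min x1 x5"
  define a where "a = x1 + 1 - c"
  define b where "b = x1 + 1 - d"
  have cd: "0 < c" "0 < d" "a + c = x1 + 1" "b + d = x1 + 1" "0 < a" "0 < b" "c \<le> x3" "d \<le> x5"
      "a \<le> x2" "b \<le> x6"
    using assms unfolding c_def d_def a_def b_def fits_def by auto
  have d': "x5 \<le> x1 \<Longrightarrow> d = x5" "x1 < x5 \<Longrightarrow> d = x1" unfolding d_def by auto
  have g: "x1 \<le> x4 \<or> a + b \<le> x4 + 1" using f cd unfolding fits_def c_def[symmetric] d_def[symmetric] by linarith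
  show ?thesis
  proof (cases "x1 < x2")
    case True
    then have x: "x4 \<le> x1" "d = x5" using r d' unfolding blocked_def by auto
    show ?thesis
    proof (cases "x4 = x1")
      case True
      show ?thesis
      proof (cases "x1 = 1")
        case T: True
        then show ?thesis using x True cd pos le by (intro framed_flatI[of 1]) auto
      next
        case False
        then show ?thesis using x True \<open>x1 < x2\<close> cd pos le
          by (intro framedI[of x1 x1 1 x1 d b]) (auto simp: frame_def)
      qed
    next
      case False
      then show ?thesis using x g cd \<open>x1 < x2\<close> pos le
        by (intro framedI[of x1 "x4 + 1 - b" "x1 + b - x4" x4 d b]) (auto simp: frame_def)
    qed
  next
    case False
    show ?thesis
    proof (cases "x1 \<le> x4 \<or> x2 + b \<le> x4 + 1")
      case T: True
      define e where "e = min x1 (x2 + b - 1)"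
      define c' where "c' = x1 + 1 - x2"
      have e: "e \<le> x4" "e = x1 \<and> x1 < x2 + b \<or> e < x1 \<and> e + 1 = x2 + b" "x2 + c' = x1 + 1" "0 < c'" "c' \<le> x3"
        using T False pos cd f unfolding e_def c'_def fits_def by linarith+
      show ?thesis
      proof (cases "x2 = b \<and> x2 = c'")
        case False
        then show ?thesis using e cd pos le
          by (intro framedI[of x1 x2 c' e d b]) (auto simp: frame_def)
      next
        case True
        \<comment> \<open>Here \<open>x1 = 2 * x2 - 1\<close>. If \<open>x6 = x2\<close>, seven
          piles of size \<open>x2\<close> are reached with \<open>x5\<close>, \<open>x6\<close>
          kept; if \<open>x2 < x6\<close>, shifting one unit from \<open>d\<close> to
          \<open>b\<close> leaves the exceptional pattern.\<close>
        consider "x1 = 1" | "x6 = x2" "d = x5" | "x1 \<noteq> 1" "x2 < x6" "d = x5"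
          using True e cd d' by linarith
        then show ?thesis
        proof cases
          case 1 then show ?thesis using True e pos le by (intro framed_flatI[of 1]) auto
        next
          case 2
          then have "x5 = x2" "x6 = x2" "0 < x2" "x2 \<le> x1" "x2 \<le> x3" "x2 \<le> x4" "x2 \<le> x7"
            using True e cd pos le by linarith+
          then show ?thesis by (intro framed_flatI[of x2]) simp_all
        next
          case 3
          then have "frame x1 x2 c' x1 (d - 1) (b + 1)" "d - 1 \<le> x5" "b + 1 \<le> x6" "x1 \<le> x4"
            using True e cd pos unfolding frame_def by linarith+
          then show ?thesis using e le by (intro framedI[of x1 x2 c' x1 "d - 1" "b + 1"]) simp_all
        qed
      qed
    next
      case F: False
      \<comment> \<open>If \<open>x1 < x5\<close>, then \<open>b = 1\<close>, so \<open>F\<close>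
        gives \<open>x4 < x2\<close>, the second alternative of \<open>blocked\<close>.\<close>
      then have "d = x5" using r d' False cd unfolding blocked_def by linarith
      then show ?thesis using F g cd False pos le
        by (intro framedI[of x1 "x4 + 1 - b" "x1 + b - x4" x4 d b]) (auto simp: frame_def)
    qed
  qed
qed

text \<open>\<open>M = 1\<close> always fits. Climbing from there, either a step from
  \<open>M\<close> to \<open>M + 1\<close> fails and \<open>framed_below\<close> applies, or
  \<open>M = x1\<close> is reached and \<open>framed_top\<close> applies.\<close>

lemma framed_if_not_blocked:
  assumes pos: "0 < x1" "0 < x2" "0 < x3" "0 < x4" "0 < x5" "0 < x6"
  and le: "x1 \<le> x7"
  and r: "\<not> blocked x1 x2 x4 x5"
  shows "framed x1 x2 x3 x4 x5 x6 x7"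
proof (rule ccontr)
  assume n: "\<not> ?thesis"
  have "1 \<le> x1" using pos by simp
  then have "fits x1 x2 x3 x4 x5 x6"
  proof (induction rule: dec_induct)
    case base
    show ?case using pos unfolding fits_def by auto
  next
    case (step M)
    have M: "0 < M" "M \<le> x1" "M \<le> x7" using step(1,2) le by simp_all
    show ?case
    proof (rule ccontr)
      assume "\<not> fits (Suc M) x2 x3 x4 x5 x6"
      from framed_below[OF pos(2-6) M step.IH this] n show False by contradiction
    qed
  qed
  from framed_top[OF pos le this r] n show False by contradiction
qed

text \<open>The conditional hypotheses belong to the bases at piles 2, 6 and 3, in both
  orientations.\<close>

lemma min_base_contradiction:
  assumes "x0 \<le> x1" "x0 \<le> x2" "x0 \<le> x6" "x1 \<le> x7"
    and "blocked x1 x2 x4 x5"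
    and "x3 \<le> x1 \<Longrightarrow> blocked x3 x4 x6 x7" "x1 \<le> x3 \<Longrightarrow> blocked x1 x0 x6 x5"
    and "x7 \<le> x5 \<Longrightarrow> blocked x7 x0 x2 x3" "x5 \<le> x7 \<Longrightarrow> blocked x5 x4 x2 x1"
    and "x4 \<le> x2 \<Longrightarrow> blocked x4 x5 x7 x0" "x2 \<le> x4 \<Longrightarrow> blocked x2 x1 x7 x6"
  shows False
proof -
  note b = assms(5-11)[unfolded blocked_def]
  \<comment> \<open>Otherwise the base at 2 yields \<open>x1 < x0\<close> or \<open>x6 < x0\<close>;
    in the next line the base at 6 yields \<open>x7 < x0\<close> or \<open>x2 < x0\<close>.\<close>
  have "x3 < x1" using assms(1-4) b(3) by linarith
  moreover have "x5 < x7" using assms(1-4) b(4) by linarith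
  moreover have "x4 < x2" using b(1,7) \<open>x3 < x1\<close> assms(4) by linarith
  \<comment> \<open>The base at 6 now gives \<open>x5 < x4\<close>, while the base at 3 asks for
    \<open>x4 < x5\<close> or \<open>x7 < x5\<close>.\<close>
  ultimately show False using assms(1-4) b(1,2,5,6) by linarith
qed

section \<open>Configurations and moves\<close>

lemma scn_same_induct [consumes 1, case_names base rotate rev]:
  assumes "scn_same xs ys" and "P ys"
    and "\<And>zs. P zs \<Longrightarrow> P (rotate1 zs)" and "\<And>zs. P zs \<Longrightarrow> P (rev zs)"
  shows "P xs"
proof -
  have "P (rotate m zs)" if "P zs" for m zs
    using that by (induction m) (auto simp: rotate_def intro: assms(3))
  then show ?thesis
    using assms unfolding scn_same_def by blast
qed

lemma scn_same_refl: "scn_same xs xs"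
  unfolding scn_same_def by (metis rotate0 id_apply)

lemma scn_same_rotate: "scn_same xs ys \<Longrightarrow> scn_same (rotate m xs) ys"
  unfolding scn_same_def by (metis rotate_rotate)

lemma scn_same_rev: "scn_same xs ys \<Longrightarrow> scn_same (rev xs) ys"
  unfolding scn_same_def by (metis rotate_rev rev_rev_ident rev_swap)

lemma scn_same_set: "scn_same xs ys \<Longrightarrow> set xs = set ys"
  by (induction rule: scn_same_induct) simp_all

lemma scn_same_length: "scn_same xs ys \<Longrightarrow> length xs = length ys"
  by (induction rule: scn_same_induct) simp_all

lemma scn_same_replicate: "scn_same xs (replicate n a) \<longleftrightarrow> xs = replicate n a"
proof
  assume "scn_same xs (replicate n a)"
  then show "xs = replicate n a"
    by (intro replicate_eqI) (auto dest: scn_same_set scn_same_length simp: set_replicate_conv_if split: if_splits)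
qed (simp add: scn_same_refl)

section \<open>Moves on eight and on seven piles\<close>

lemma less_8D: "(i::nat) < 8 \<Longrightarrow> i = 0 \<or> i = 1 \<or> i = 2 \<or> i = 3 \<or> i = 4 \<or> i = 5 \<or> i = 6 \<or> i = 7"
  by linarith

text \<open>A window of six among eight piles leaves out two adjacent piles.\<close>

definition keeps :: "nat list \<Rightarrow> nat list \<Rightarrow> bool" where
  "keeps xs ys \<longleftrightarrow> length xs = 8 \<and> length ys = 8 \<and> (\<forall>i<8. ys ! i \<le> xs ! i) \<and>
     (\<exists>i<8. ys ! i = xs ! i \<and> ys ! (Suc i mod 8) = xs ! (Suc i mod 8))"

lemma keeps_iff:
  "keeps [x0, x1, x2, x3, x4, x5, x6, x7] [y0, y1, y2, y3, y4, y5, y6, y7] \<longleftrightarrow>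
    y0 \<le> x0 \<and> y1 \<le> x1 \<and> y2 \<le> x2 \<and> y3 \<le> x3 \<and> y4 \<le> x4 \<and> y5 \<le> x5 \<and> y6 \<le> x6 \<and> y7 \<le> x7 \<and>
    (y0 = x0 \<and> y1 = x1 \<or> y1 = x1 \<and> y2 = x2 \<or> y2 = x2 \<and> y3 = x3 \<or> y3 = x3 \<and> y4 = x4 \<or>
     y4 = x4 \<and> y5 = x5 \<or> y5 = x5 \<and> y6 = x6 \<or> y6 = x6 \<and> y7 = x7 \<or> y7 = x7 \<and> y0 = x0)"
proof -
  have *: "(\<forall>i<8. P i) \<longleftrightarrow> P 0 \<and> P 1 \<and> P 2 \<and> P 3 \<and> P 4 \<and> P 5 \<and> P 6 \<and> P 7"
    "(\<exists>i<8. P i) \<longleftrightarrow> P 0 \<or> P 1 \<or> P 2 \<or> P 3 \<or> P 4 \<or> P 5 \<or> P 6 \<or> P 7" for P :: "nat \<Rightarrow> bool"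
    by (simp_all add: numeral_eq_Suc All_less_Suc Ex_less_Suc) blast+
  show ?thesis unfolding keeps_def * by simp
qed

lemma keeps_rotate1:
  assumes "keeps xs ys" shows "keeps (rotate1 xs) (rotate1 ys)"
proof -
  have n: "rotate1 xs ! i = xs ! (Suc i mod 8)" "rotate1 ys ! i = ys ! (Suc i mod 8)" if "i < 8" for i
    using that assms by (simp_all add: nth_rotate1 keeps_def)
  obtain i where i: "i < 8" "ys ! i = xs ! i" "ys ! (Suc i mod 8) = xs ! (Suc i mod 8)"
    using assms unfolding keeps_def by blast
  \<comment> \<open>\<open>(i + 7) mod 8\<close> is \<open>i - 1\<close> on the circle, as
    \<open>rotate1\<close> moves entries one place down.\<close>
  have j: "(i + 7) mod 8 < 8" "Suc ((i + 7) mod 8) mod 8 = i" using i(1) by presburger+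
  show ?thesis unfolding keeps_def
  proof (intro conjI exI[of _ "(i + 7) mod 8"])
    show "rotate1 ys ! ((i + 7) mod 8) = rotate1 xs ! ((i + 7) mod 8)"
      using n j i by simp
    show "rotate1 ys ! (Suc ((i + 7) mod 8) mod 8) = rotate1 xs ! (Suc ((i + 7) mod 8) mod 8)"
      unfolding j(2) using n i by simp
  qed (use assms n j(1) in \<open>simp_all add: keeps_def\<close>)
qed

lemma keeps_rotate: "keeps xs ys \<Longrightarrow> keeps (rotate m xs) (rotate m ys)"
  by (induction m) (auto simp: rotate_def keeps_rotate1)

lemma keeps_rev:
  assumes "keeps xs ys" shows "keeps (rev xs) (rev ys)"
proof -
  have n: "rev xs ! i = xs ! (7 - i)" "rev ys ! i = ys ! (7 - i)" if "i < 8" for i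
    using that assms by (simp_all add: rev_nth keeps_def)
  obtain i where i: "i < 8" "ys ! i = xs ! i" "ys ! (Suc i mod 8) = xs ! (Suc i mod 8)"
    using assms unfolding keeps_def by blast
  \<comment> \<open>Reversal sends the kept positions \<open>i\<close>, \<open>i + 1\<close> to
    \<open>7 - i\<close>, \<open>6 - i\<close>; the new pair starts at \<open>6 - i\<close>, which
    is \<open>14 - i\<close> modulo 8.\<close>
  have j: "(14 - i) mod 8 < 8" "7 - (14 - i) mod 8 = Suc i mod 8" "7 - (Suc ((14 - i) mod 8) mod 8) = i"
    "Suc ((14 - i) mod 8) mod 8 < 8"
    using less_8D[OF i(1)] by (elim disjE; simp)+
  show ?thesis unfolding keeps_def
  proof (intro conjI exI[of _ "(14 - i) mod 8"])
    show "rev ys ! ((14 - i) mod 8) = rev xs ! ((14 - i) mod 8)"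
      unfolding n[OF j(1)] j(2) by (rule i)
    show "rev ys ! (Suc ((14 - i) mod 8) mod 8) = rev xs ! (Suc ((14 - i) mod 8) mod 8)"
      unfolding n[OF j(4)] j(3) by (rule i)
  qed (use assms n j(1) in \<open>simp_all add: keeps_def\<close>)
qed

lemma scn_move_alt:
  "scn_move k xs zs \<longleftrightarrow> (\<exists>ys. length ys = length xs \<and> (\<forall>i<length xs. ys ! i \<le> xs ! i) \<and>
     (\<exists>W\<in>scn_windows k (length xs). \<forall>i<length xs. i \<notin> W \<longrightarrow> ys ! i = xs ! i) \<and>
     ys \<noteq> xs \<and> zs = filter ((<) 0) ys)"
  unfolding scn_move_def by blast

text \<open>The window starting at \<open>i\<close> misses exactly the positions
  \<open>i + 6\<close> and \<open>i + 7\<close> modulo 8, and every adjacent pair is missed by some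
  window.\<close>

lemma scn_move_8:
  assumes "length xs = 8"
  shows "scn_move 6 xs zs \<longleftrightarrow> (\<exists>ys. keeps xs ys \<and> ys \<noteq> xs \<and> zs = filter ((<) 0) ys)"
proof -
  have six: "{..<6::nat} = {0, 1, 2, 3, 4, 5}" by auto
  have w: "k \<notin> (\<lambda>j. (i + j) mod 8) ` {..<6} \<longleftrightarrow> k = (i + 6) mod 8 \<or> k = Suc ((i + 6) mod 8) mod 8"
    if "i < 8" "k < 8" for i k :: nat
    unfolding six using less_8D[OF that(1)] less_8D[OF that(2)] by (elim disjE; simp)
  have s: "\<exists>j<8. i = (j + 6) mod 8" if "i < 8" for i :: nat
    using less_8D[OF that] by (intro exI[of _ "(i + 2) mod 8"]) (elim disjE; simp)
  have E: "(\<exists>W\<in>scn_windows 6 8. \<forall>k<8. k \<notin> W \<longrightarrow> ys ! k = xs ! k) \<longleftrightarrow>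
    (\<exists>i<8. ys ! i = xs ! i \<and> ys ! (Suc i mod 8) = xs ! (Suc i mod 8))" for ys
  proof -
    have "(\<exists>W\<in>scn_windows 6 8. \<forall>k<8. k \<notin> W \<longrightarrow> ys ! k = xs ! k) \<longleftrightarrow>
      (\<exists>i<8. \<forall>k<8. k \<notin> (\<lambda>j. (i + j) mod 8) ` {..<6} \<longrightarrow> ys ! k = xs ! k)"
      unfolding scn_windows_def by blast
    also have "\<dots> \<longleftrightarrow> (\<exists>i<8. \<forall>k<8. k = (i + 6) mod 8 \<or> k = Suc ((i + 6) mod 8) mod 8 \<longrightarrow> ys ! k = xs ! k)"
      by (simp add: w cong: conj_cong del: image_iff)
    also have "\<dots> \<longleftrightarrow> (\<exists>i<8. ys ! i = xs ! i \<and> ys ! (Suc i mod 8) = xs ! (Suc i mod 8))"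
    proof
      assume "\<exists>i<8. \<forall>k<8. k = (i + 6) mod 8 \<or> k = Suc ((i + 6) mod 8) mod 8 \<longrightarrow> ys ! k = xs ! k"
      then obtain i where h: "\<forall>k<8. k = (i + 6) mod 8 \<or> k = Suc ((i + 6) mod 8) mod 8 \<longrightarrow> ys ! k = xs ! k"
        by blast
      then show "\<exists>i<8. ys ! i = xs ! i \<and> ys ! (Suc i mod 8) = xs ! (Suc i mod 8)"
        using h[rule_format, of "(i + 6) mod 8"] h[rule_format, of "Suc ((i + 6) mod 8) mod 8"]
        by (intro exI[of _ "(i + 6) mod 8"]) simp
    next
      assume "\<exists>i<8. ys ! i = xs ! i \<and> ys ! (Suc i mod 8) = xs ! (Suc i mod 8)"
      then show "\<exists>i<8. \<forall>k<8. k = (i + 6) mod 8 \<or> k = Suc ((i + 6) mod 8) mod 8 \<longrightarrow> ys ! k = xs ! k"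
        using s by metis
    qed
    finally show ?thesis .
  qed
  show ?thesis
    unfolding scn_move_alt keeps_def assms E by simp
qed

lemma scn_move_7:
  assumes "length xs = 7"
  shows "scn_move 6 xs zs \<longleftrightarrow> (\<exists>ys. length ys = 7 \<and> (\<forall>i<7. ys ! i \<le> xs ! i) \<and>
    (\<exists>i<7. ys ! i = xs ! i) \<and> ys \<noteq> xs \<and> zs = filter ((<) 0) ys)"
proof -
  have six: "{..<6::nat} = {0, 1, 2, 3, 4, 5}" by auto
  have less_7D: "i = 0 \<or> i = 1 \<or> i = 2 \<or> i = 3 \<or> i = 4 \<or> i = 5 \<or> i = 6" if "i < 7" for i :: nat
    using that by linarith
  have w: "k \<notin> (\<lambda>j. (i + j) mod 7) ` {..<6} \<longleftrightarrow> k = (i + 6) mod 7" if "i < 7" "k < 7" for i k :: nat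
    unfolding six using less_7D[OF that(1)] less_7D[OF that(2)] by (elim disjE; simp)
  have s: "\<exists>j<7. i = (j + 6) mod 7" if "i < 7" for i :: nat
    using less_7D[OF that] by (intro exI[of _ "(i + 1) mod 7"]) (elim disjE; simp)
  have E: "(\<exists>W\<in>scn_windows 6 7. \<forall>k<7. k \<notin> W \<longrightarrow> ys ! k = xs ! k) \<longleftrightarrow>
    (\<exists>i<7. ys ! i = xs ! i)" for ys
  proof -
    have "(\<exists>W\<in>scn_windows 6 7. \<forall>k<7. k \<notin> W \<longrightarrow> ys ! k = xs ! k) \<longleftrightarrow>
      (\<exists>i<7. \<forall>k<7. k \<notin> (\<lambda>j. (i + j) mod 7) ` {..<6} \<longrightarrow> ys ! k = xs ! k)"
      unfolding scn_windows_def by blast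
    also have "\<dots> \<longleftrightarrow> (\<exists>i<7. \<forall>k<7. k = (i + 6) mod 7 \<longrightarrow> ys ! k = xs ! k)"
      by (simp add: w cong: conj_cong del: image_iff)
    also have "\<dots> \<longleftrightarrow> (\<exists>i<7. ys ! ((i + 6) mod 7) = xs ! ((i + 6) mod 7))" by simp
    also have "\<dots> \<longleftrightarrow> (\<exists>i<7. ys ! i = xs ! i)"
      by (metis s mod_less_divisor zero_less_numeral)
    finally show ?thesis .
  qed
  show ?thesis
    unfolding scn_move_alt assms E by simp
qed

lemma scn_move_Nil:
  assumes "xs \<noteq> []" "length xs \<le> 6" "\<forall>x\<in>set xs. 0 < x"
  shows "scn_move 6 xs []"
proof -
  let ?W = "(\<lambda>j. (0 + j) mod length xs) ` {..<6}"
  have "?W \<in> scn_windows 6 (length xs)" unfolding scn_windows_def using assms by blast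
  moreover have "i \<in> ?W" if "i < length xs" for i
    using that assms by (intro image_eqI[of _ _ i]) auto
  moreover have "replicate (length xs) 0 \<noteq> xs" using assms by (cases xs) auto
  ultimately show ?thesis
    unfolding scn_move_def by (intro bexI[of _ ?W] exI[of _ "replicate (length xs) 0"]) auto
qed

section \<open>Termination and recognition of losing configurations\<close>

lemma sum_list_filter_pos: "sum_list (filter ((<) 0) ys) = sum_list (ys :: nat list)"
  by (induction ys) simp_all

lemma scn_move_decreases:
  assumes "scn_move k xs zs"
  shows "sum_list zs < sum_list xs"
proof -
  obtain ys where ys: "length ys = length xs" "\<forall>i<length xs. ys ! i \<le> xs ! i" "ys \<noteq> xs"
    "zs = filter ((<) 0) ys"
    using assms unfolding scn_move_def by blast
  have "sum_list zs = sum_list ys" unfolding ys(4) by (rule sum_list_filter_pos)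
  also have "\<dots> = (\<Sum>i<length xs. ys ! i)" by (simp add: sum_list_sum_nth ys(1) atLeast0LessThan)
  also have "\<dots> < (\<Sum>i<length xs. xs ! i)"
  proof (intro sum_strict_mono_ex1)
    obtain i where "i < length xs" "ys ! i \<noteq> xs ! i"
      using ys(1,3) by (auto simp: list_eq_iff_nth_eq)
    then show "\<exists>i\<in>{..<length xs}. ys ! i < xs ! i" using ys(2) le_neq_implies_less by blast
  qed (use ys(2) in simp_all)
  also have "\<dots> = sum_list xs" by (simp add: sum_list_sum_nth atLeast0LessThan)
  finally show ?thesis .
qed

lemma scn_move_config:
  assumes "scn_move k xs zs" "scn_config n xs"
  shows "scn_config n zs"
proof -
  obtain ys where "length ys = length xs" "zs = filter ((<) 0) ys"
    using assms(1) unfolding scn_move_def by blast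
  then show ?thesis
    using assms(2) length_filter_le[of "(<) 0" ys] unfolding scn_config_def by auto
qed

text \<open>Every move lowers the number of stones, so induction on this number identifies the
  losing configurations with \<open>S\<close>, provided that no move stays in \<open>S\<close> and
  every configuration outside can move into it.\<close>

lemma scn_loses_iff:
  assumes stay: "\<And>xs ys. scn_config n xs \<Longrightarrow> S xs \<Longrightarrow> scn_move k xs ys \<Longrightarrow> \<not> S ys"
    and reach: "\<And>xs. scn_config n xs \<Longrightarrow> \<not> S xs \<Longrightarrow> \<exists>ys. scn_move k xs ys \<and> S ys"
    and "scn_config n xs"
  shows "scn_loses k xs \<longleftrightarrow> S xs"
proof -
  have "(scn_loses k xs \<longleftrightarrow> S xs) \<and> (scn_wins k xs \<longleftrightarrow> \<not> S xs)"
    using assms(3)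
  proof (induction "sum_list xs" arbitrary: xs rule: less_induct)
    case less
    have IH: "(scn_loses k ys \<longleftrightarrow> S ys) \<and> (scn_wins k ys \<longleftrightarrow> \<not> S ys)" if "scn_move k xs ys" for ys
      using less that scn_move_decreases scn_move_config by blast
    have "scn_loses k xs \<longleftrightarrow> (\<forall>ys. scn_move k xs ys \<longrightarrow> scn_wins k ys)"
      by (subst scn_loses.simps) blast
    moreover have "scn_wins k xs \<longleftrightarrow> (\<exists>ys. scn_move k xs ys \<and> scn_loses k ys)"
      by (subst scn_wins.simps) blast
    ultimately show ?case using IH stay reach less.prems by blast
  qed
  then show ?thesis by blast
qed

section \<open>The lost configurations\<close>

definition crown :: "nat \<Rightarrow> nat \<Rightarrow> nat \<Rightarrow> nat list" where
  "crown M a b = [1, M, a, M - a + 1, min M (a + b - 1), M - b + 1, b, M]"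

text \<open>\<open>M = 2 * a - 1 \<and> a = b\<close> is the exceptional case, where the move to \<open>(a, a, a, a, a, a, a)\<close> exists.\<close>

definition crown_like :: "nat list \<Rightarrow> bool" where
  "crown_like xs \<longleftrightarrow> (\<exists>M a b. 1 \<le> a \<and> a \<le> M \<and> 1 \<le> b \<and> b \<le> M \<and>
     \<not> (M = 2 * a - 1 \<and> a = b) \<and> scn_same xs (crown M a b))"

text \<open>Seven equal piles before the emptied eighth pile vanishes.\<close>

definition gapped :: "nat list \<Rightarrow> bool" where
  "gapped xs \<longleftrightarrow> (\<exists>c>0. scn_same xs [0, c, c, c, c, c, c, c])"

section \<open>Symmetries of the eight-pile pattern\<close>

lemma length_crown: "length (crown M a b) = 8"
  by (simp add: crown_def)

text \<open>Reading the pattern backwards exchanges \<open>a\<close> and \<open>b\<close>; this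
  reduces reflections to rotations.\<close>

lemma rev_crown: "rev (crown M a b) = rotate 1 (crown M b a)"
  by (simp add: crown_def add.commute)

lemma scn_same_crown:
  assumes "scn_same xs (crown M a b)"
  obtains m where "m < 8" "xs = rotate m (crown M a b)"
    | m where "m < 8" "xs = rotate m (crown M b a)"
proof -
  have r: "rotate m zs = rotate (m mod 8) zs" if "length zs = 8" for m and zs :: "nat list"
    using rotate_conv_mod[of m zs] that by simp
  obtain m where "xs = rotate m (crown M a b) \<or> xs = rotate (m + 1) (crown M b a)"
    using assms unfolding scn_same_def rev_crown rotate_rotate by blast
  then have "xs = rotate (m mod 8) (crown M a b) \<or> xs = rotate ((m + 1) mod 8) (crown M b a)"
    using r[of "crown M a b" m] r[of "crown M b a" "m + 1"] unfolding length_crown by metis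
  then show ?thesis
    by (elim disjE) (erule that[rotated], simp)+
qed

text \<open>Every pile of size \<open>1\<close> can serve as the distinguished first pile.\<close>

lemma rotate_crown:
  assumes "1 \<le> a" "a \<le> M" "1 \<le> b" "b \<le> M" "m < 8" "crown M a b ! m = 1"
  obtains a' b' where "rotate m (crown M a b) = crown M a' b'" "1 \<le> a'" "a' \<le> M" "1 \<le> b'" "b' \<le> M"
    "M = 2 * a' - 1 \<and> a' = b' \<longleftrightarrow> M = 2 * a - 1 \<and> a = b"
proof -
  note r = rotate_drop_take crown_def
  have "min M (a + b - 1) = 1 \<Longrightarrow> M = 1 \<or> a = 1 \<and> b = 1" using assms(1-4) by linarith
  then consider "m = 0" | "m = 1" "M = 1" | "m = 2" "a = 1" | "m = 3" "a = M" | "m = 4" "M = 1 \<or> a = 1 \<and> b = 1"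
    | "m = 5" "b = M" | "m = 6" "b = 1" | "m = 7" "M = 1"
    using assms less_8D[OF assms(5)] unfolding crown_def by (elim disjE) auto
  \<comment> \<open>The new parameters are read off two places after and two places before the pile
    chosen as first.\<close>
  then show ?thesis
  proof cases
    case 1 then show ?thesis using assms by (intro that[of a b]) auto
  next
    case 2 then show ?thesis using assms by (intro that[of 1 1]) (auto simp: r)
  next
    case 3 then show ?thesis using assms by (intro that[of b 1]) (auto simp: r)
  next
    case 4 then show ?thesis using assms by (intro that[of "M - b + 1" M]) (auto simp: r)
  next
    case 5 then show ?thesis using assms by (intro that[of 1 1]) (auto simp: r)
  next
    case 6 then show ?thesis using assms by (intro that[of M "M - a + 1"]) (auto simp: r)
  next
    case 7 then show ?thesis using assms by (intro that[of 1 a]) (auto simp: r)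
  next
    case 8 then show ?thesis using assms by (intro that[of 1 1]) (auto simp: r)
  qed
qed

lemma scn_same_crown_rebase:
  assumes "scn_same xs (crown M a b)" "1 \<le> a" "a \<le> M" "1 \<le> b" "b \<le> M" "xs ! 0 = 1"
  obtains a' b' where "xs = crown M a' b'" "1 \<le> a'" "a' \<le> M" "1 \<le> b'" "b' \<le> M"
    "M = 2 * a' - 1 \<and> a' = b' \<longleftrightarrow> M = 2 * a - 1 \<and> a = b"
  using assms(1)
proof (cases rule: scn_same_crown)
  case (1 m)
  then have "crown M a b ! m = 1" using assms by (simp add: nth_rotate length_crown)
  from rotate_crown[OF assms(2-5) 1(1) this] that show ?thesis unfolding 1(2) by blast
next
  case (2 m)
  then have "crown M b a ! m = 1" using assms by (simp add: nth_rotate length_crown)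
  from rotate_crown[OF assms(4,5,2,3) 2(1) this] that show ?thesis unfolding 2(2) by blast
qed

text \<open>Rebased at a common pile of size \<open>1\<close>, two representations have the same
  parameters, so being exceptional is a property of the configuration. Hence excluding parameters,
  as in \<open>crown_like\<close>, amounts to removing configurations.\<close>

lemma crown_like_iff:
  "crown_like xs \<longleftrightarrow> (\<exists>M a b. 1 \<le> a \<and> a \<le> M \<and> 1 \<le> b \<and> b \<le> M \<and> scn_same xs (crown M a b)) \<and>
     \<not> (\<exists>p\<ge>1. scn_same xs (crown (2 * p - 1) p p))" (is "_ \<longleftrightarrow> ?C \<and> \<not> ?E")
proof -
  have conflict: "False" if c: "scn_same xs (crown M a b)" "1 \<le> a" "a \<le> M" "1 \<le> b" "b \<le> M" "\<not> (M = 2 * a - 1 \<and> a = b)"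
    and p: "1 \<le> p" "scn_same xs (crown (2 * p - 1) p p)" for M a b p
  proof -
    obtain m where m: "rotate m xs ! 0 = 1"
    proof -
      have "1 \<in> set xs" using scn_same_set[OF p(2)] by (simp add: crown_def)
      then obtain m where "m < length xs" "xs ! m = 1" by (auto simp: in_set_conv_nth)
      then show ?thesis using nth_rotate[of 0 xs m] by (intro that[of m]) (cases "xs = []"; simp)
    qed
    obtain a1 b1 where 1: "rotate m xs = crown M a1 b1" "\<not> (M = 2 * a1 - 1 \<and> a1 = b1)"
      by (rule scn_same_crown_rebase[OF scn_same_rotate[OF c(1)] c(2-5) m]) (use c(6) in blast)
    have "p \<le> 2 * p - 1" using p(1) by simp
    obtain a2 b2 where 2: "rotate m xs = crown (2 * p - 1) a2 b2" "2 * p - 1 = 2 * a2 - 1 \<and> a2 = b2"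
      by (rule scn_same_crown_rebase[OF scn_same_rotate[OF p(2)] p(1) \<open>p \<le> 2 * p - 1\<close> p(1) \<open>p \<le> 2 * p - 1\<close> m])
        blast
    show False using 1 2 by (simp add: crown_def)
  qed
  show ?thesis
  proof
    assume "crown_like xs"
    then obtain M a b where c: "scn_same xs (crown M a b)" "1 \<le> a" "a \<le> M" "1 \<le> b" "b \<le> M"
      "\<not> (M = 2 * a - 1 \<and> a = b)"
      unfolding crown_like_def by blast
    have "\<not> ?E" using conflict[OF c] by blast
    with c show "?C \<and> \<not> ?E" by blast
  next
    assume h: "?C \<and> \<not> ?E"
    then obtain M a b where c: "1 \<le> a" "a \<le> M" "1 \<le> b" "b \<le> M" "scn_same xs (crown M a b)"
      by blast
    have "\<not> (M = 2 * a - 1 \<and> a = b)" using h c(1,5) by auto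
    with c show "crown_like xs" unfolding crown_like_def by blast
  qed
qed

section \<open>Moves from the eight-pile pattern\<close>

text \<open>Every kept pair forces \<open>M' = M\<close>: it contains \<open>M\<close>, or has sum
  \<open>M + 1\<close>, or consists of the middle pile and a neighbour, and then a smaller
  \<open>M'\<close> would lower both arguments of the minimum. For equal \<open>M\<close> the piles
  \<open>a\<close> and \<open>M - a + 1\<close> change in opposite directions, so neither can
  shrink.\<close>

lemma keeps_crowns:
  assumes "keeps (crown M a b) (crown M' a' b')"
    and "1 \<le> a" "a \<le> M" "1 \<le> b" "b \<le> M" "1 \<le> a'" "a' \<le> M'" "1 \<le> b'" "b' \<le> M'"
  shows "crown M' a' b' = crown M a b"
proof -
  note k = assms(1)[unfolded crown_def keeps_iff]
  have le: "M' \<le> M" "a' \<le> a" "M' - a' + 1 \<le> M - a + 1" "M' - b' + 1 \<le> M - b + 1" "b' \<le> b"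
    and al: "min M' (a' + b' - 1) \<le> min M (a + b - 1)"
    using k by blast+
  have le': "M' + a \<le> M + a'" "M' + b \<le> M + b'" using le assms(2-) by linarith+
  have "M' = M \<or> a' = a \<and> M' - a' + 1 = M - a + 1 \<or> b' = b \<and> M' - b' + 1 = M - b + 1 \<or>
      M' - a' + 1 = M - a + 1 \<and> min M' (a' + b' - 1) = min M (a + b - 1) \<or>
      M' - b' + 1 = M - b + 1 \<and> min M' (a' + b' - 1) = min M (a + b - 1)"
    using k by (elim conjE disjE) simp_all
  then have "M' = M"
    using le le' assms(2-) by (elim disjE conjE) linarith+
  moreover from this have "a' = a" "b' = b"
    using le le' by linarith+
  ultimately show ?thesis by simp
qed

lemma gapped_cases:
  assumes "gapped xs"
  obtains c m where "0 < c" "m < 8" "xs = rotate m [0, c, c, c, c, c, c, c]"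
proof -
  obtain c m where "0 < c" "xs = rotate m [0, c, c, c, c, c, c, c] \<or> xs = rotate m (rotate 1 [0, c, c, c, c, c, c, c])"
    using assms unfolding gapped_def scn_same_def by auto
  moreover define m' where "m' = (if xs = rotate m [0, c, c, c, c, c, c, c] then m else m + 1)"
  ultimately have "0 < c" "xs = rotate m' [0, c, c, c, c, c, c, c]"
    unfolding rotate_rotate by (auto split: if_splits)
  moreover have "rotate m' [0, c, c, c, c, c, c, c] = rotate (m' mod 8) [0, c, c, c, c, c, c, c]"
    by (subst rotate_conv_mod) simp
  ultimately show ?thesis by (intro that[of c "m' mod 8"]) simp_all
qed

text \<open>If the emptied pile is not the first one, then \<open>c = 1\<close>, and two kept
  neighbours of size \<open>1\<close> force \<open>M = 1\<close>. Otherwise the other seven piles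
  are at least \<open>c\<close> and two kept neighbours equal \<open>c\<close>, which forces
  \<open>M = 1\<close> or \<open>a = p = q = b = c\<close>.\<close>

lemma keeps_crown_gapped_exceptional:
  assumes "keeps (crown M a b) xs" "gapped xs" "1 \<le> a" "a \<le> M" "1 \<le> b" "b \<le> M"
  shows "M = 2 * a - 1 \<and> a = b"
  using assms(2)
proof (cases rule: gapped_cases)
  case (1 c m)
  define p q e where "p = M - a + 1" and "q = M - b + 1" and "e = min M (a + b - 1)"
  have e: "e = M \<and> M < a + b \<or> e < M \<and> e + 1 = a + b" and pq: "a + p = M + 1" "b + q = M + 1"
    using assms(3-6) unfolding p_def q_def e_def by linarith+
  have k: "keeps [1, M, a, p, e, q, b, M] (rotate m [0, c, c, c, c, c, c, c])"
    using assms(1) unfolding 1(3) crown_def p_def q_def e_def .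
  have "M + 1 = 2 * a \<and> a = b"
    using less_8D[OF 1(2)]
    by (elim disjE; use k e pq 1(1) assms(3-6) in \<open>simp add: rotate_drop_take keeps_iff\<close>;
      elim conjE disjE; intro conjI; linarith)
  then show ?thesis by linarith
qed

lemma filter_gapped: "gapped xs \<Longrightarrow> \<exists>c>0. filter ((<) 0) xs = replicate 7 c"
proof (elim gapped_cases)
  fix c m :: nat assume c: "0 < c" and "m < 8" and xs: "xs = rotate m [0, c, c, c, c, c, c, c]"
  have "replicate 7 c = [c, c, c, c, c, c, c]" by (simp add: eval_nat_numeral)
  with c less_8D[OF \<open>m < 8\<close>] show ?thesis
    unfolding xs by (intro exI[of _ c]) (elim disjE; simp add: rotate_drop_take)
qed

text \<open>Seven survivors among eight piles leave exactly one \<open>0\<close>; cutting the circle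
  there puts it first.\<close>

lemma gapped_if_filter:
  assumes "length xs = 8" "filter ((<) 0) xs = replicate 7 c" "0 < c"
  shows "gapped xs"
proof -
  have "filter ((<) 0) xs \<noteq> xs"
  proof
    assume "filter ((<) 0) xs = xs"
    then have "xs = replicate 7 c" using assms(2) by simp
    then show False using assms(1) by simp
  qed
  then have "0 \<in> set xs" using filter_True[of xs "(<) 0"] by (metis gr0I)
  then obtain us vs where xs: "xs = us @ 0 # vs" by (auto simp: in_set_conv_decomp)
  have f: "filter ((<) 0) (us @ vs) = replicate 7 c" using assms(2) unfolding xs by simp
  have len: "length (us @ vs) = 7" using assms(1) unfolding xs by simp
  have "\<forall>x\<in>set (us @ vs). 0 < x"
    using length_filter_less[of _ "us @ vs" "(<) 0"] f len by (metis length_replicate less_irrefl)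
  then have "us @ vs = replicate 7 c" using f filter_True by metis
  then have "\<forall>x\<in>set (us @ vs). x = c" by simp
  then have "vs @ us = replicate 7 c" using len by (intro replicate_eqI) auto
  then have "(0 # vs) @ us = [0, c, c, c, c, c, c, c]" by (simp add: eval_nat_numeral)
  then have "xs = rotate (length (0 # vs)) [0, c, c, c, c, c, c, c]"
    unfolding xs using rotate_append[of "0 # vs" us] by simp
  then show ?thesis using assms(3) unfolding gapped_def scn_same_def by blast
qed

section \<open>Every eight-pile configuration reaches a target\<close>

text \<open>Admitting \<open>ys = xs\<close> covers the targets themselves, so the property can be
  shown for all eight-pile configurations.\<close>

definition steerable :: "nat list \<Rightarrow> bool" where
  "steerable xs \<longleftrightarrow> (\<exists>ys. keeps xs ys \<and> (crown_like ys \<or> gapped ys))"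

lemma steerable_rotate: "steerable xs \<Longrightarrow> steerable (rotate m xs)"
  unfolding steerable_def crown_like_def gapped_def by (metis keeps_rotate scn_same_rotate)

lemma steerable_rev: "steerable xs \<Longrightarrow> steerable (rev xs)"
  unfolding steerable_def crown_like_def gapped_def by (metis keeps_rev scn_same_rev)

lemma steerable_rotate_iff:
  assumes "length xs = 8"
  shows "steerable (rotate m xs) \<longleftrightarrow> steerable xs"
proof
  assume "steerable (rotate m xs)"
  \<comment> \<open>The shift \<open>8 * m - m\<close> completes \<open>m\<close> to a multiple of
    8.\<close>
  then have "steerable (rotate (8 * m - m) (rotate m xs))" by (rule steerable_rotate)
  moreover have "rotate (8 * m - m) (rotate m xs) = xs"
    unfolding rotate_rotate using assms by (intro rotate_id) simp
  ultimately show "steerable xs" by simp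
qed (rule steerable_rotate)

lemma steerable_rev_iff: "steerable (rev xs) \<longleftrightarrow> steerable xs"
  using steerable_rev[of "rev xs"] steerable_rev by auto

lemma steerable_if_framed:
  assumes "framed x1 x2 x3 x4 x5 x6 x7" "0 < x0"
  shows "steerable [x0, x1, x2, x3, x4, x5, x6, x7]"
  using assms(1)
proof cases
  case (framedI M a c e d b)
  have ab: "1 \<le> a" "a \<le> M" "1 \<le> b" "b \<le> M" "c = M - a + 1" "d = M - b + 1" "e = min M (a + b - 1)"
    "\<not> (M = 2 * a - 1 \<and> a = b)"
    using framedI(1) unfolding frame_def by auto
  have "crown M a b = [1, M, a, c, e, d, b, M]" unfolding crown_def ab ..
  moreover have "keeps [x0, x1, x2, x3, x4, x5, x6, x7] [1, M, a, c, e, d, b, M]"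
    using framedI(2-8) assms(2) framedI(9) unfolding keeps_iff by (elim disjE) simp_all
  moreover have "crown_like (crown M a b)"
    unfolding crown_like_def using ab scn_same_refl by blast
  ultimately show ?thesis unfolding steerable_def by metis
next
  case (framed_flatI c)
  have "keeps [x0, x1, x2, x3, x4, x5, x6, x7] [0, c, c, c, c, c, c, c]"
    using framed_flatI(2-8) framed_flatI(9) unfolding keeps_iff by (elim disjE) simp_all
  moreover have "gapped [0, c, c, c, c, c, c, c]"
    unfolding gapped_def using framed_flatI(1) scn_same_refl by blast
  ultimately show ?thesis unfolding steerable_def by blast
qed

lemma length_8D: "length ys = 8 \<Longrightarrow> \<exists>y0 y1 y2 y3 y4 y5 y6 y7. ys = [y0, y1, y2, y3, y4, y5, y6, y7]"
  by (auto simp: length_Suc_conv numeral_eq_Suc)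

text \<open>A counterexample is \<open>blocked\<close> at every base, in the orientation in which
  the smaller neighbour follows. Turned so that a smallest pile comes first, and reflected if
  necessary, it contradicts \<open>min_base_contradiction\<close>.\<close>

lemma steerable_8:
  assumes "length xs = 8" "\<forall>x\<in>set xs. 0 < x"
  shows "steerable xs"
proof (rule ccontr)
  assume n: "\<not> steerable xs"
  define P where "P ys \<longleftrightarrow> length ys = 8 \<and> (\<forall>y\<in>set ys. 0 < y) \<and> \<not> steerable ys" for ys
  have rot: "P (rotate m ys)" if "P ys" for m ys
    using that unfolding P_def by (auto simp: steerable_rotate_iff)
  \<comment> \<open>Reversal followed by a rotation by seven fixes the first pile.\<close>
  have ref: "P (rotate 7 (rev ys))" if "P ys" for ys
    using that by (intro rot) (simp add: P_def steerable_rev_iff)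
  have turn: "P [y1, y2, y3, y4, y5, y6, y7, y0]" if "P [y0, y1, y2, y3, y4, y5, y6, y7]" for y0 y1 y2 y3 y4 y5 y6 y7
    using rot[OF that, of 1] by simp
  have flip: "P [y0, y7, y6, y5, y4, y3, y2, y1]" if "P [y0, y1, y2, y3, y4, y5, y6, y7]" for y0 y1 y2 y3 y4 y5 y6 y7
    using ref[OF that] by (simp add: rotate_drop_take)
  have stuck: "blocked y1 y2 y4 y5"
    if "P [y0, y1, y2, y3, y4, y5, y6, y7]" "y1 \<le> y7" for y0 y1 y2 y3 y4 y5 y6 y7
    using framed_if_not_blocked[of y1 y2 y3 y4 y5 y6 y7] steerable_if_framed[of y1 y2 y3 y4 y5 y6 y7 y0] that
    unfolding P_def by auto
  have contra: False if p: "P [y0, y1, y2, y3, y4, y5, y6, y7]"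
    and m: "y0 \<le> y1" "y0 \<le> y2" "y0 \<le> y6" "y1 \<le> y7" for y0 y1 y2 y3 y4 y5 y6 y7
  proof -
    note p1 = turn[OF p] note p2 = turn[OF p1] note p3 = turn[OF p2]
    note p4 = turn[OF p3] note p5 = turn[OF p4] note p6 = turn[OF p5]
    show False
      by (rule min_base_contradiction[OF m stuck[OF p m(4)] stuck[OF p2] stuck[OF flip[OF p2]]
        stuck[OF p6] stuck[OF flip[OF p6]] stuck[OF p3] stuck[OF flip[OF p3]]])
  qed
  define z where "z = Min (set xs)"
  have "set xs \<noteq> {}" using assms(1) by auto
  then have z: "z \<in> set xs" "\<forall>x\<in>set xs. z \<le> x" unfolding z_def by simp_all
  then obtain i where "i < 8" "xs ! i = z" using assms(1) by (auto simp: in_set_conv_nth)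
  then have h: "rotate i xs ! 0 = z" using nth_rotate[of 0 xs i] assms(1) by simp
  have "P xs" using n assms unfolding P_def by simp
  then have P: "P (rotate i xs)" by (rule rot)
  have "length (rotate i xs) = 8" using assms(1) by simp
  then obtain y0 y1 y2 y3 y4 y5 y6 y7 where ys: "rotate i xs = [y0, y1, y2, y3, y4, y5, y6, y7]"
    using length_8D by blast
  have "set xs = {y0, y1, y2, y3, y4, y5, y6, y7}" using arg_cong[OF ys, of set] by simp
  then have m: "y0 \<le> y1" "y0 \<le> y2" "y0 \<le> y6" "y0 \<le> y7" using z(2) h ys by auto
  show False
    using contra[OF P[unfolded ys] m(1-3)] contra[OF flip[OF P[unfolded ys]] m(4) m(3) m(2)] by linarith
qed

section \<open>The lost configurations and the theorem\<close>

definition lost :: "nat list \<Rightarrow> bool" where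
  "lost xs \<longleftrightarrow> xs = [] \<or> (\<exists>c>0. xs = replicate 7 c) \<or> crown_like xs"

lemma crown_like_length: "crown_like xs \<Longrightarrow> length xs = 8"
  unfolding crown_like_def using scn_same_length length_crown by metis

lemma crown_like_pos: "crown_like xs \<Longrightarrow> \<forall>x\<in>set xs. 0 < x"
  unfolding crown_like_def using scn_same_set by (fastforce simp: crown_def)

lemma filter_pos_id: "\<forall>x\<in>set xs. 0 < x \<Longrightarrow> filter ((<) (0::nat)) xs = xs"
  by (rule filter_True) simp

text \<open>All notions are invariant under rotation and reflection, so \<open>xs\<close> may be
  taken as the crown itself. In a crown-like target the first pile is still \<open>1\<close>, so the
  target is a crown with the same first pile; seven equal piles arise only in the exceptional
  case.\<close>

lemma keeps_crown_like_stay: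
  assumes "crown_like xs" "keeps xs ys" "crown_like ys \<or> gapped ys"
  shows "ys = xs"
proof -
  obtain M a b where c: "1 \<le> a" "a \<le> M" "1 \<le> b" "b \<le> M" "\<not> (M = 2 * a - 1 \<and> a = b)"
    and "scn_same xs (crown M a b)" using assms(1) unfolding crown_like_def by blast
  from this(6) have "\<forall>ys. keeps xs ys \<and> (crown_like ys \<or> gapped ys) \<longrightarrow> ys = xs"
  proof (induction rule: scn_same_induct)
    case base
    show ?case
    proof (intro allI impI, elim conjE)
      fix ys assume k: "keeps (crown M a b) ys" and "crown_like ys \<or> gapped ys"
      then show "ys = crown M a b"
      proof (elim disjE)
        assume cl: "crown_like ys"
        then obtain M' a' b' where c': "1 \<le> a'" "a' \<le> M'" "1 \<le> b'" "b' \<le> M'" "scn_same ys (crown M' a' b')"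
          unfolding crown_like_def by blast
        have "ys ! 0 \<le> crown M a b ! 0" and len: "length ys = 8" using k unfolding keeps_def by simp_all
        then have "ys ! 0 \<le> 1" by (simp add: crown_def)
        moreover have "0 < ys ! 0" using crown_like_pos[OF cl] len by simp
        ultimately have "ys ! 0 = 1" by simp
        then obtain a1 b1 where "ys = crown M' a1 b1" "1 \<le> a1" "a1 \<le> M'" "1 \<le> b1" "b1 \<le> M'"
          by (rule scn_same_crown_rebase[OF c'(5,1-4)])
        then show ?thesis using keeps_crowns k c by blast
      next
        assume "gapped ys"
        then show ?thesis using keeps_crown_gapped_exceptional[OF k _ c(1-4)] c(5) by blast
      qed
    qed
  next
    case (rotate zs)
    show ?case
    proof (intro allI impI, elim conjE)
      fix ys assume k: "keeps (rotate1 zs) ys" and t: "crown_like ys \<or> gapped ys"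
      have len: "length zs = 8" "length ys = 8" using k by (simp_all add: keeps_def)
      have "rotate 7 (rotate1 zs) = zs" "rotate1 (rotate 7 ys) = ys"
        using len rotate_id[of 8 zs] rotate_id[of 8 ys] rotate_rotate[of 7 1 zs] rotate_rotate[of 1 7 ys] by simp_all
      moreover have "keeps (rotate 7 (rotate1 zs)) (rotate 7 ys)" using k by (rule keeps_rotate)
      moreover have "crown_like (rotate 7 ys) \<or> gapped (rotate 7 ys)"
        using t scn_same_rotate unfolding crown_like_def gapped_def by blast
      ultimately show "ys = rotate1 zs" using rotate by metis
    qed
  next
    case (rev zs)
    show ?case
    proof (intro allI impI, elim conjE)
      fix ys assume k: "keeps (rev zs) ys" and t: "crown_like ys \<or> gapped ys"
      have "keeps zs (rev ys)" using keeps_rev[OF k] by simp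
      moreover have "crown_like (rev ys) \<or> gapped (rev ys)"
        using t scn_same_rev unfolding crown_like_def gapped_def by blast
      ultimately show "ys = rev zs" using rev by (metis rev_rev_ident)
    qed
  qed
  then show ?thesis using assms(2,3) by blast
qed

lemma scn_move_keeps:
  assumes "length xs = 8" "scn_move 6 xs zs"
  obtains ys where "keeps xs ys" "ys \<noteq> xs" "zs = filter ((<) 0) ys"
  using assms scn_move_8 by blast

lemma lost_stay:
  assumes "scn_config 8 xs" "lost xs" "scn_move 6 xs zs"
  shows "\<not> lost zs"
proof
  assume z: "lost zs"
  consider "xs = []" | c where "0 < c" "xs = replicate 7 c" | "crown_like xs"
    using assms(2) unfolding lost_def by blast
  then show False
  proof cases
    case 1
    then show False using scn_move_decreases[OF assms(3)] by simp
  next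
    case (2 c)
    then obtain ys i where ys: "length ys = 7" "i < 7" "ys ! i = c" "ys \<noteq> xs" "zs = filter ((<) 0) ys"
      using assms(3) scn_move_7[of xs zs] by auto
    \<comment> \<open>An untouched pile survives and at most seven piles remain, so a lost
      \<open>zs\<close> must be \<open>replicate 7 c\<close>.\<close>
    have "c \<in> set zs" using ys 2(1) by (auto simp: in_set_conv_nth)
    moreover have "length zs \<le> 7" using ys length_filter_le[of "(<) 0" ys] by simp
    ultimately have zs: "zs = replicate 7 c" using z crown_like_length[of zs] unfolding lost_def by auto
    then have "ys = zs" using ys length_filter_less[of _ ys "(<) 0"] filter_True[of ys "(<) 0"]
      by (metis length_replicate less_irrefl)
    then show False using zs ys(4) 2(2) by simp
  next
    case 3
    obtain ys where ys: "keeps xs ys" "ys \<noteq> xs" "zs = filter ((<) 0) ys"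
      using scn_move_keeps[OF crown_like_length[OF 3] assms(3)] .
    have len: "length ys = 8" using ys(1) by (simp add: keeps_def)
    have "\<exists>i<8. 0 < ys ! i"
      using ys(1) 3 crown_like_length[OF 3] crown_like_pos[OF 3] nth_mem unfolding keeps_def by metis
    then have "zs \<noteq> []" using len ys(3) by (auto simp: filter_empty_conv)
    then consider c where "0 < c" "zs = replicate 7 c" | "crown_like zs" using z unfolding lost_def by blast
    then have "crown_like ys \<or> gapped ys"
    proof cases
      case (1 c)
      then show ?thesis using gapped_if_filter[of ys c] len ys(3) by simp
    next
      case 2
      have "ys = zs" using crown_like_length[OF 2] len ys(3) length_filter_less[of _ ys "(<) 0"] filter_True[of ys "(<) 0"]
        by (metis less_irrefl)
      then show ?thesis using 2 by simp
    qed
    then show False using keeps_crown_like_stay[OF 3 ys(1)] ys(2) by blast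
  qed
qed

lemma lost_reach:
  assumes "scn_config 8 xs" "\<not> lost xs"
  shows "\<exists>zs. scn_move 6 xs zs \<and> lost zs"
proof -
  have len: "length xs \<le> 8" and pos: "\<forall>x\<in>set xs. 0 < x" using assms(1) unfolding scn_config_def by auto
  have ne: "xs \<noteq> []" using assms(2) unfolding lost_def by blast
  consider "length xs \<le> 6" | "length xs = 7" | "length xs = 8" using len by linarith
  then show ?thesis
  proof cases
    case 1
    then show ?thesis using scn_move_Nil[OF ne _ pos] unfolding lost_def by blast
  next
    case 2
    define c where "c = Min (set xs)"
    have c: "c \<in> set xs" "\<forall>x\<in>set xs. c \<le> x" using ne unfolding c_def by simp_all
    have "0 < c" using c pos by blast
    obtain i where i: "i < 7" "xs ! i = c" using c(1) 2 by (auto simp: in_set_conv_nth)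
    have "xs \<noteq> replicate 7 c" using assms(2) \<open>0 < c\<close> unfolding lost_def by blast
    \<comment> \<open>Cutting all piles to the minimum leaves a smallest pile untouched, as a move
      on seven piles requires.\<close>
    then have "scn_move 6 xs (replicate 7 c)"
      unfolding scn_move_7[OF 2] using c i 2 \<open>0 < c\<close>
      by (intro exI[of _ "replicate 7 c"]) (auto intro: exI[of _ i])
    then show ?thesis using \<open>0 < c\<close> unfolding lost_def by blast
  next
    case 3
    obtain ys where ys: "keeps xs ys" "crown_like ys \<or> gapped ys"
      using steerable_8[OF 3 pos] unfolding steerable_def by blast
    have "lost (filter ((<) 0) ys)"
      using ys(2) filter_gapped[of ys] filter_pos_id[OF crown_like_pos] unfolding lost_def by metis
    \<comment> \<open>Equality is impossible: \<open>xs\<close> is not crown-like, and it contains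
      no \<open>0\<close>.\<close>
    moreover have "ys \<noteq> xs"
    proof
      assume "ys = xs"
      then have "gapped xs" using ys(2) assms(2) unfolding lost_def by blast
      then have "0 \<in> set xs" unfolding gapped_def using scn_same_set by fastforce
      then show False using pos by blast
    qed
    ultimately show ?thesis using ys(1) scn_move_8[OF 3] by blast
  qed
qed

lemma lost_config: "lost xs \<Longrightarrow> scn_config 8 xs"
  unfolding lost_def scn_config_def using crown_like_length[of xs] crown_like_pos[of xs] by auto

theorem theorem3p9:
  "scn_P_positions 8 6 =
     {xs. scn_same xs []}
     \<union> {xs. \<exists>a::nat. a \<ge> 1 \<and> scn_same xs [a, a, a, a, a, a, a]}
     \<union> ({xs. \<exists>M a b \<alpha> :: nat. M \<ge> 1 \<and> a \<ge> 1 \<and> b \<ge> 1 \<and> a \<le> M \<and> b \<le> M \<and>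
              \<alpha> = min M (a + b - 1) \<and>
              scn_same xs [1, M, a, M - a + 1, \<alpha>, M - b + 1, b, M]}
        - {xs. \<exists>p::nat. p \<ge> 1 \<and>
              scn_same xs [1, 2 * p - 1, p, p, 2 * p - 1, p, p, 2 * p - 1]})"
proof -
  have empty: "scn_same xs [] \<longleftrightarrow> xs = []" for xs
    using scn_same_replicate[of xs 0 0] by simp
  have seven: "(\<exists>a::nat. a \<ge> 1 \<and> scn_same xs [a, a, a, a, a, a, a]) \<longleftrightarrow> (\<exists>c>0. xs = replicate 7 c)" for xs
  proof -
    have "[a, a, a, a, a, a, a] = replicate 7 a" for a :: nat by (simp add: eval_nat_numeral)
    then show ?thesis by (auto simp: scn_same_replicate Suc_le_eq)
  qed
  have eight: "(\<exists>M a b \<alpha> :: nat. M \<ge> 1 \<and> a \<ge> 1 \<and> b \<ge> 1 \<and> a \<le> M \<and> b \<le> M \<and>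
              \<alpha> = min M (a + b - 1) \<and>
              scn_same xs [1, M, a, M - a + 1, \<alpha>, M - b + 1, b, M]) \<and>
      \<not> (\<exists>p::nat. p \<ge> 1 \<and> scn_same xs [1, 2 * p - 1, p, p, 2 * p - 1, p, p, 2 * p - 1])
    \<longleftrightarrow> crown_like xs" for xs
  proof -
    have "crown (2 * p - 1) p p = [1, 2 * p - 1, p, p, 2 * p - 1, p, p, 2 * p - 1]" if "1 \<le> p" for p
      using that by (auto simp: crown_def)
    then have "(\<exists>p\<ge>1. scn_same xs (crown (2 * p - 1) p p)) \<longleftrightarrow>
      (\<exists>p::nat. p \<ge> 1 \<and> scn_same xs [1, 2 * p - 1, p, p, 2 * p - 1, p, p, 2 * p - 1])" by metis
    then show ?thesis
      unfolding crown_like_iff crown_def[of "_ :: nat", symmetric]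
      by (auto simp: crown_def intro: order_trans)
  qed
  have P: "scn_P_positions 8 6 = {xs. lost xs}"
  proof -
    have "scn_loses 6 xs \<longleftrightarrow> lost xs" if "scn_config 8 xs" for xs
      using lost_stay lost_reach that by (rule scn_loses_iff)
    then show ?thesis unfolding scn_P_positions_def using lost_config by blast
  qed
  show ?thesis
    by (rule set_eqI) (simp only: P lost_def Un_iff Diff_iff mem_Collect_eq empty seven eight disj_assoc)
qed

end
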